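(* Let $p$ be a prime and let $w:\mathbb{F}_p^3\to\mathbb{Z}_{\ge 0}$ be a $p$-divisible multiset, that is, for every affine plane $H\subseteq\mathbb{F}_p^3$, $$\sum_{x\in H} w(x)\equiv 0\pmod p.$$ Assume moreover that $\sum_{x\in\mathbb{F}_p^3} w(x)=p^2$. Then for any affine plane $H\subseteq\mathbb{F}_p^3$, $$w-\mathbf{1}_H\in\operatorname{Span}_{\mathbb{Z}}\{\mathbf{1}_{\ell_1}-\mathbf{1}_{\ell_2} : \ell_1,\ell_2 \text{ affine lines in } \mathbb{F}_p^3,\ \ell_1\parallel\ell_2\}.$$ Equivalently, $w$ is a $\mathbb{Z}$-linear combination of characteristic functions of cylinders.
   Context: Lines and planes are affine one- and two-dimensional subspaces of $\mathbb{F}_p^3$. For $X\subseteq\mathbb{F}_p^3$, $\mathbf{1}_X:\mathbb{F}_p^3\to\mathbb{Z}$ denotes its characteristic function. Write $\ell_1\parallel\ell_2$ if the lines $\ell_1,\ell_2$ are parallel. A cylinder is a subset of $\mathbb{F}_p^3$ that is the union of $p$ pairwise disjoint parallel lines. $\operatorname{Span}_{\mathbb{Z}}$ denotes the set of finite integer linear combinations. *)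

theory Defs
  imports
    "HOL-Analysis.Analysis"
    "HOL-Library.Function_Algebras"
    "Berlekamp_Zassenhaus.Finite_Field"
begin

text \<open>
  \<open>'p mod_ring\<close> with \<open>'p :: prime_card\<close> is the prime field with \<open>p = CARD('p)\<close> elements.
\<close>

type_synonym 'p space = "('p mod_ring) ^ 3"

text \<open>
  The library constant \<open>affine\<close> is restricted to real vector spaces.
\<close>

definition affine_subspace :: "nat \<Rightarrow> ('p :: prime_card) space set \<Rightarrow> bool" where
  "affine_subspace k X \<longleftrightarrow>
     (\<exists>V a. vec.subspace V \<and> vec.dim V = k \<and> X = (\<lambda>v. a + v) ` V)"

definition line :: "('p :: prime_card) space set \<Rightarrow> bool" where
  "line X \<longleftrightarrow> affine_subspace 1 X"

definition plane :: "('p :: prime_card) space set \<Rightarrow> bool" where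
  "plane X \<longleftrightarrow> affine_subspace 2 X"

text \<open>
  Parallel lines are translates of each other, so every line is parallel to itself.
\<close>

definition parallel :: "('p :: prime_card) space set \<Rightarrow> 'p space set \<Rightarrow> bool"
    (infix "\<parallel>" 50) where
  "X \<parallel> Y \<longleftrightarrow> (\<exists>a. Y = (\<lambda>x. a + x) ` X)"

definition cylinder :: "('p :: prime_card) space set \<Rightarrow> bool" where
  "cylinder C \<longleftrightarrow>
     (\<exists>L. card L = CARD('p) \<and> (\<forall>l\<in>L. line l) \<and> pairwise (\<parallel>) L \<and> pairwise disjnt L \<and>
          C = \<Union>L)"

definition p_divisible :: "(('p :: prime_card) space \<Rightarrow> nat) \<Rightarrow> bool" where
  "p_divisible w \<longleftrightarrow> (\<forall>H. plane H \<longrightarrow> [(\<Sum>x\<in>H. w x) = 0] (mod CARD('p)))"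

abbreviation char_fun :: "('p :: prime_card) space set \<Rightarrow> 'p space \<Rightarrow> int" where
  "char_fun \<equiv> indicator"

text \<open>
  The integer-valued functions as a \<open>\<int>\<close>-module; \<open>int_fun.span\<close> is the set of
  finite integer linear combinations.
\<close>

interpretation int_fun: Modules.module "\<lambda>(c :: int) (f :: 'a \<Rightarrow> int) x. c * f x"
  by unfold_locales (simp_all add: fun_eq_iff algebra_simps)

end

(*
  Work modulo p first. By expanding the indicator of a point, 1 - (x - y)^(p-1) in each coordinate,
  a function f : F_p^3 -> F_p is written in monomials whose coefficients are combinations of moments
  of f. If all plane sums of f vanish, then so do all its moments of degree at most p - 1, so only
  monomials of degree at most 2p - 3 occur. On the other hand, the lines with direction (1, -a, -b)
  are parametrized by (u, v) = (a x + y, b x + z), so the differences of parallel lines generate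
  u^r v^s unless r = s = p - 1 (the sum of u^r v^s over F_p^2 vanishes); reading these as polynomials
  in a and b yields exactly the monomials of degree at most 2p - 3. Finally, nothing is lost modulo p:
  the indicators of the p + 1 lines through x in a plane P add up to the indicator of P plus p times
  that of x, whence p times a difference of two points is a combination of differences of parallel lines.
*)

theory Submission
  imports Defs
begin

section \<open>Polynomial functions over the prime field\<close>

text \<open>
  \<open>dual_monom k y\<close> is the coefficient of \<open>x ^ k\<close> in \<open>1 - (x - y) ^ (p - 1)\<close>, since
  \<open>(x - y) ^ (p - 1) = (\<Sum>k<p. x ^ k * y ^ (p - 1 - k))\<close> modulo \<open>p\<close>.
\<close>

definition dual_monom :: "nat \<Rightarrow> 'p :: prime_card mod_ring \<Rightarrow> 'p mod_ring" where
  "dual_monom k y = of_bool (k = 0) - y ^ (CARD('p) - 1 - k)"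

lemma mod_ring_power_card [simp]: "(x :: 'p :: prime_card mod_ring) ^ CARD('p) = x"
  using finite_field_power_card_eq_same[of x] by simp

text \<open>With \<open>?S\<close> the geometric sum in \<open>x\<close> and \<open>y\<close>,
  \<open>(x - y) * ?S = x ^ p - y ^ p = x - y\<close>, so \<open>?S\<close> is 1 off the diagonal;
  on the diagonal it is a sum of p equal terms, hence 0.\<close>

lemma sum_dual_monom:
  fixes x y :: "'p :: prime_card mod_ring"
  shows "(\<Sum>k<CARD('p). x ^ k * dual_monom k y) = of_bool (x = y)"
proof -
  let ?S = "\<Sum>k<CARD('p). y ^ (CARD('p) - Suc k) * x ^ k"
  have "(\<Sum>k<CARD('p). x ^ k * dual_monom k y)
      = (\<Sum>k<CARD('p). (if k = 0 then 1 else 0) - y ^ (CARD('p) - Suc k) * x ^ k)"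
    by (rule sum.cong) (auto simp: dual_monom_def algebra_simps)
  also have "\<dots> = 1 - ?S"
    by (simp add: sum_subtractf)
  also have "?S = of_bool (x \<noteq> y)"
  proof (cases "x = y")
    case True
    have "?S = (\<Sum>k<CARD('p). x ^ (CARD('p) - 1))"
      unfolding True by (rule sum.cong) (auto simp flip: power_add)
    then show ?thesis using True by simp
  next
    case False
    have "(x - y) * ?S = x - y"
      using power_diff_sumr2[of x "CARD('p)" y] by simp
    then show ?thesis using False by simp
  qed
  finally show ?thesis by simp
qed

text \<open>Biorthogonality: interpolating \<open>t ^ m\<close> through point indicators gives a
  polynomial of degree below p with these sums as coefficients. It agrees with the monomial at all p
  points, so the two coincide as polynomials.\<close>

lemma sum_dual_monom_power:
  assumes "m < CARD('p)" "k < CARD('p)"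
  shows "(\<Sum>t\<in>UNIV. dual_monom k t * t ^ m) = (of_bool (m = k) :: 'p :: prime_card mod_ring)"
proof -
  define c :: "nat \<Rightarrow> 'p mod_ring" where "c k = (\<Sum>t\<in>UNIV. dual_monom k t * t ^ m)" for k
  define P where "P = (\<Sum>k<CARD('p). Polynomial.monom (c k) k)"
  have "poly P x = poly (Polynomial.monom 1 m) x" for x
  proof -
    have "poly P x = (\<Sum>t\<in>UNIV. (\<Sum>k<CARD('p). x ^ k * dual_monom k t) * t ^ m)"
      unfolding P_def c_def poly_sum poly_monom sum_distrib_left sum_distrib_right
      by (subst sum.swap) (simp add: mult_ac)
    also have "\<dots> = (\<Sum>t\<in>UNIV. if x = t then t ^ m else 0)"
      unfolding sum_dual_monom by (rule sum.cong) auto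
    finally show ?thesis by (simp add: poly_monom)
  qed
  moreover have "Polynomial.degree P < CARD('p)"
    unfolding P_def by (rule degree_sum_less) (auto intro: le_less_trans[OF degree_monom_le])
  moreover have "Polynomial.degree (Polynomial.monom (1 :: 'p mod_ring) m) < CARD('p)"
    using assms by (simp add: degree_monom_eq)
  ultimately have "P = Polynomial.monom 1 m"
    by (intro poly_eqI_degree[where A = UNIV]) auto
  then have "Polynomial.coeff P k = Polynomial.coeff (Polynomial.monom 1 m) k" by simp
  moreover have "Polynomial.coeff P k = c k"
    using assms by (simp add: P_def coeff_sum)
  ultimately show ?thesis by (simp add: c_def)
qed

text \<open>For \<open>k = p - 1\<close> the dual monomial is the constant -1, so biorthogonality
  applies. The bound is sharp: for \<open>m = p - 1\<close> the sum is -1.\<close>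

lemma sum_power_eq_0:
  assumes "m < CARD('p) - 1"
  shows "(\<Sum>t\<in>UNIV. t ^ m) = (0 :: 'p :: prime_card mod_ring)"
proof -
  have "CARD('p) - 1 \<noteq> 0" using assms by linarith
  then have "dual_monom (CARD('p) - 1) t = - 1" for t :: "'p mod_ring"
    by (simp add: dual_monom_def)
  with sum_dual_monom_power[of m "CARD('p) - 1", where 'p = 'p] assms show ?thesis
    by (simp add: sum_negf)
qed

text \<open>By biorthogonality, a coefficient of a polynomial of degree below p is a fixed linear
  combination of its p values. It inherits whatever is stable under linear combinations; below, the
  variable is a slope parameter of lines or planes.\<close>

lemma extract_coeff:
  fixes c :: "nat \<Rightarrow> 'p :: prime_card mod_ring"
  assumes "k < CARD('p)"
  shows "c k = (\<Sum>t\<in>UNIV. dual_monom k t * (\<Sum>m<CARD('p). t ^ m * c m))"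
proof -
  have "(\<Sum>t\<in>UNIV. dual_monom k t * (\<Sum>m<CARD('p). t ^ m * c m))
      = (\<Sum>m<CARD('p). (\<Sum>t\<in>UNIV. dual_monom k t * t ^ m) * c m)"
    unfolding sum_distrib_left sum_distrib_right by (subst sum.swap) (simp add: mult_ac)
  also have "\<dots> = (\<Sum>m<CARD('p). if m = k then c m else 0)"
    by (rule sum.cong) (use assms in \<open>auto simp: sum_dual_monom_power\<close>)
  finally show ?thesis using assms by simp
qed

text \<open>The binomial coefficient divides \<open>fact r\<close>, which is prime to p.\<close>

lemma binomial_mod_ring_neq_0:
  assumes "i \<le> r" "r < CARD('p)"
  shows "(of_nat (r choose i) :: 'p :: prime_card mod_ring) \<noteq> 0"
proof
  assume "(of_nat (r choose i) :: 'p mod_ring) = 0"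
  then have "CARD('p) dvd r choose i" by (rule of_nat_0_mod_ring_dvd)
  then have "CARD('p) dvd fact r"
    using binomial_fact_lemma[OF assms(1)] by (metis dvd_mult)
  with assms(2) show False by (simp add: prime_dvd_fact_iff prime_card)
qed

text \<open>The index runs over all \<open>i < p\<close> to match \<open>extract_coeff\<close>;
  where \<open>i > r\<close> and \<open>r - i\<close> is truncated, the binomial coefficient is
  0.\<close>

lemma binomial_expand:
  fixes y u :: "'p :: prime_card mod_ring"
  assumes "r < CARD('p)"
  shows "(a * u + y) ^ r = (\<Sum>i<CARD('p). a ^ i * (of_nat (r choose i) * (u ^ i * y ^ (r - i))))"
proof -
  have "(a * u + y) ^ r = (\<Sum>i\<le>r. a ^ i * (of_nat (r choose i) * (u ^ i * y ^ (r - i))))"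
    by (simp add: binomial_ring power_mult_distrib mult_ac)
  also have "\<dots> = (\<Sum>i<CARD('p). a ^ i * (of_nat (r choose i) * (u ^ i * y ^ (r - i))))"
  proof (rule sum.mono_neutral_left)
    show "\<forall>i\<in>{..<CARD('p)} - {..r}. a ^ i * (of_nat (r choose i) * (u ^ i * y ^ (r - i))) = 0"
      by (simp add: not_le binomial_eq_0)
    show "{..r} \<subseteq> {..<CARD('p)}"
      using assms by (intro subsetI) simp
  qed simp
  finally show ?thesis .
qed

section \<open>Lines and planes\<close>

definition line_through :: "'p :: prime_card space \<Rightarrow> 'p space \<Rightarrow> 'p space set" where
  "line_through a v = (\<lambda>s. a + s *s v) ` UNIV"

lemma line_line_through:
  assumes "v \<noteq> 0"
  shows "line (line_through a v)"
proof -
  have "vec.dim (vec.span {v}) = card {v}"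
    using assms by (intro vec.dim_span_eq_card_independent) (simp add: vec.dependent_single)
  moreover have "line_through a v = (\<lambda>x. a + x) ` vec.span {v}"
    by (simp add: line_through_def vec.span_singleton image_image)
  ultimately show ?thesis
    unfolding line_def affine_subspace_def using vec.subspace_span[of "{v}"]
    by (metis card.empty card.insert empty_iff finite.emptyI One_nat_def)
qed

lemma line_through_translate: "line_through (b + a) v = (\<lambda>x. b + x) ` line_through a v"
  unfolding line_through_def by (simp add: image_image add.assoc)

lemma parallel_line_through: "line_through a v \<parallel> line_through b v"
  unfolding parallel_def
  by (rule exI[of _ "b - a"]) (simp flip: line_through_translate)

abbreviation line_diffs :: "('p :: prime_card space \<Rightarrow> int) set" where
  "line_diffs \<equiv> {char_fun l1 - char_fun l2 | l1 l2. line l1 \<and> line l2 \<and> l1 \<parallel> l2}"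

lemma line_through_diff_in_span:
  "v \<noteq> 0 \<Longrightarrow> char_fun (line_through a v) - char_fun (line_through b v) \<in> int_fun.span line_diffs"
  by (rule int_fun.span_base) (use line_line_through parallel_line_through in blast)

lemma card_line_through:
  fixes v :: "'p :: prime_card space"
  assumes "v \<noteq> 0"
  shows "card (line_through a v) = CARD('p)"
proof -
  have "inj (\<lambda>s. a + s *s v)"
    using assms by (auto intro!: injI)
  then show ?thesis by (simp add: line_through_def card_image)
qed

lemma line_eq_line_through:
  assumes "line l"
  obtains a v where "v \<noteq> 0" "l = line_through a v"
proof -
  obtain V a where V: "vec.subspace V" "vec.dim V = 1" "l = (\<lambda>v. a + v) ` V"
    using assms unfolding line_def affine_subspace_def by blast
  obtain B where B: "B \<subseteq> V" "vec.independent B" "V \<subseteq> vec.span B" "card B = vec.dim V"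
    using vec.basis_exists by blast
  with V obtain v where "B = {v}" by (metis card_1_singletonE)
  with B V have "v \<noteq> 0" "V = vec.span {v}"
    using vec.span_subspace[of B V] by (auto simp: vec.dependent_single)
  with V have "l = line_through a v"
    by (simp add: line_through_def vec.span_singleton image_image)
  with \<open>v \<noteq> 0\<close> show ?thesis by (rule that)
qed

lemma plane_parametrization:
  assumes "plane H"
  obtains a u v where "bij_betw (\<lambda>(s, t). a + s *s u + t *s v) UNIV H"
proof -
  obtain V a where V: "vec.subspace V" "vec.dim V = 2" "H = (\<lambda>v. a + v) ` V"
    using assms unfolding plane_def affine_subspace_def by blast
  obtain B where B: "B \<subseteq> V" "vec.independent B" "V \<subseteq> vec.span B" "card B = vec.dim V"
    using vec.basis_exists by blast
  with V obtain u v where uv: "B = {u, v}" "u \<noteq> v" by (metis card_2_iff)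
  with B V have ind: "vec.independent {u, v}" and V': "V = vec.span {u, v}"
    using vec.span_subspace[of B V] by auto
  have "V = range (\<lambda>(s, t). s *s u + t *s v)"
  proof (intro equalityI subsetI)
    fix x assume "x \<in> V"
    then obtain s where "x - s *s u \<in> vec.span {v}"
      unfolding V' vec.span_insert by blast
    then obtain t where "x - s *s u = t *s v"
      unfolding vec.span_singleton by blast
    then have "x = (\<lambda>(s, t). s *s u + t *s v) (s, t)"
      by (simp add: diff_eq_eq add.commute)
    then show "x \<in> range (\<lambda>(s, t). s *s u + t *s v)" by blast
  next
    fix x assume "x \<in> range (\<lambda>(s, t). s *s u + t *s v)"
    then obtain s t where "x = s *s u + t *s v" by auto
    then show "x \<in> V"
      unfolding V' by (simp add: vec.span_add vec.span_base vec.span_scale)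
  qed
  then have "range (\<lambda>(s, t). a + s *s u + t *s v) = H"
    unfolding V(3) by (simp add: image_image case_prod_unfold add.assoc)
  moreover have "inj (\<lambda>(s, t). a + s *s u + t *s v)"
  proof (rule injI)
    fix q q' assume eq: "(\<lambda>(s, t). a + s *s u + t *s v) q = (\<lambda>(s, t). a + s *s u + t *s v) q'"
    obtain s t s' t' where q: "q = (s, t)" "q' = (s', t')" by (metis prod.exhaust)
    from eq have "a + s *s u + t *s v = a + s' *s u + t' *s v" by (simp only: q prod.case)
    moreover have "(s - s') *s u - (t' - t) *s v = (a + s *s u + t *s v) - (a + s' *s u + t' *s v)"
      by (simp add: vec_eq_iff algebra_simps)
    ultimately have *: "(s - s') *s u = (t' - t) *s v"
      by (simp only: diff_self right_minus_eq)
    have "s = s'"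
    proof (rule ccontr)
      assume "s \<noteq> s'"
      then have "inverse (s - s') * (s - s') = 1" by simp
      then have "u = inverse (s - s') *s ((s - s') *s u)" by (simp only: vec.scale_scale vec.scale_one)
      then have "u = inverse (s - s') *s ((t' - t) *s v)" by (simp only: *)
      moreover have "inverse (s - s') *s ((t' - t) *s v) \<in> vec.span {v}"
        by (intro vec.span_scale vec.span_base) simp
      ultimately have "u \<in> vec.span {v}" by (simp only:)
      with ind uv(2) show False by (auto simp: vec.independent_insert)
    qed
    moreover have "v \<noteq> 0" using ind vec.dependent_zero by blast
    ultimately show "q = q'" using * q by simp
  qed
  ultimately show ?thesis
    using that by (auto simp: bij_betw_def)
qed

text \<open>The form in which \<open>p_divisible\<close> is applied: with third coefficient 1,
  \<open>a\<close> and \<open>b\<close> are free parameters in which power sums can be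
  expanded.\<close>

lemma plane_graph:
  fixes a b c :: "'p :: prime_card mod_ring"
  shows "plane {X. a * X $ 1 + b * X $ 2 + X $ 3 = c}"
proof -
  let ?u = "vector [1, 0, - a] :: 'p space" and ?v = "vector [0, 1, - b] :: 'p space"
  let ?V = "{X :: 'p space. a * X $ 1 + b * X $ 2 + X $ 3 = 0}"
  have sub: "vec.subspace ?V"
  proof (rule vec.subspaceI)
    fix X Y assume "X \<in> ?V" "Y \<in> ?V"
    moreover have "a * (X + Y) $ 1 + b * (X + Y) $ 2 + (X + Y) $ 3
        = (a * X $ 1 + b * X $ 2 + X $ 3) + (a * Y $ 1 + b * Y $ 2 + Y $ 3)"
      by (simp add: algebra_simps)
    ultimately show "X + Y \<in> ?V" by simp
  next
    fix k X assume "X \<in> ?V"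
    moreover have "a * (k *s X) $ 1 + b * (k *s X) $ 2 + (k *s X) $ 3
        = k * (a * X $ 1 + b * X $ 2 + X $ 3)"
      by (simp add: algebra_simps)
    ultimately show "k *s X \<in> ?V" by simp
  qed simp
  have ind: "vec.independent {?u, ?v}" "?u \<noteq> ?v"
    by (auto simp: vec.independent_insert vec.dependent_single vec.span_singleton vec_eq_iff forall_3)
  have "?V \<subseteq> vec.span {?u, ?v}"
  proof
    fix X assume "X \<in> ?V"
    then have "X $ 3 = - a * X $ 1 - b * X $ 2"
      by (auto simp: algebra_simps eq_neg_iff_add_eq_0)
    then have "X = X $ 1 *s ?u + X $ 2 *s ?v"
      by (simp add: vec_eq_iff forall_3)
    then show "X \<in> vec.span {?u, ?v}"
      by (metis insertI1 insertI2 vec.span_add vec.span_base vec.span_scale)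
  qed
  moreover have "{?u, ?v} \<subseteq> ?V" by auto
  ultimately have "vec.dim ?V = card {?u, ?v}"
    by (intro vec.dim_eq_card[OF _ ind(1)]) (simp add: vec.span_subspace sub vec.span_eq_iff[THEN iffD2])
  then have "vec.dim ?V = 2" using ind by simp
  moreover have "{X. a * X $ 1 + b * X $ 2 + X $ 3 = c} = (\<lambda>v. vector [0, 0, c] + v) ` ?V" (is "?H = _")
  proof (intro equalityI subsetI)
    fix X assume "X \<in> ?H"
    then have "X = vector [0, 0, c] + (X - vector [0, 0, c])" "(X - vector [0, 0, c] :: 'p space) \<in> ?V"
      by (auto simp: algebra_simps)
    then show "X \<in> (\<lambda>v. vector [0, 0, c] + v) ` ?V" by blast
  qed (auto simp: algebra_simps)
  ultimately show ?thesis
    using sub unfolding plane_def affine_subspace_def by blast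
qed

section \<open>Reduction modulo \<open>p\<close>\<close>

lemma sum_fun_apply: "(\<Sum>i\<in>A. f i) x = (\<Sum>i\<in>A. f i x)"
  by (induction A rule: infinite_finite_induct) auto

lemma int_fun_span_scale:
  "f \<in> int_fun.span S \<Longrightarrow> (\<lambda>x. c * f x) \<in> int_fun.span S"
  by (rule int_fun.span_scale)

lemma int_fun_span_sum:
  "(\<And>i. i \<in> A \<Longrightarrow> f i \<in> int_fun.span S) \<Longrightarrow> (\<lambda>x. \<Sum>i\<in>A. f i x) \<in> int_fun.span S"
proof -
  have "(\<lambda>x. \<Sum>i\<in>A. f i x) = sum f A" by (simp add: fun_eq_iff sum_fun_apply)
  then show "(\<And>i. i \<in> A \<Longrightarrow> f i \<in> int_fun.span S) \<Longrightarrow> (\<lambda>x. \<Sum>i\<in>A. f i x) \<in> int_fun.span S"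
    by (simp add: int_fun.span_sum)
qed

lemma mem_line_through: "z \<in> line_through x v \<longleftrightarrow> (\<exists>s. z - x = s *s v)"
  by (auto simp: line_through_def image_iff diff_eq_eq add.commute)

lemma p_delta_diff_in_span:
  fixes x y :: "'p :: prime_card space"
  shows "(\<lambda>z. int CARD('p) * (of_bool (z = x) - of_bool (z = y))) \<in> int_fun.span line_diffs"
proof -
  let ?e1 = "vector [1, 0, 0] :: 'p space" and ?e2 = "vector [0, 1, 0] :: 'p space"
  let ?d = "\<lambda>t. vector [1, t, 0] :: 'p space"
  have nz: "?e1 \<noteq> 0" "?e2 \<noteq> 0" "?d t \<noteq> 0" for t
    by (auto simp: vec_eq_iff forall_3)
  \<comment> \<open>The first two terms are the p + 1 lines through \<open>x\<close> in the plane
    through \<open>x\<close> parallel to the first two axes; the subtracted sum is this plane, cut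
    into lines along \<open>?e1\<close>.\<close>
  define S where "S x z = (\<Sum>t\<in>UNIV. char_fun (line_through x (?d t)) z)
      + char_fun (line_through x ?e2) z - (\<Sum>s\<in>UNIV. char_fun (line_through (x + s *s ?e2) ?e1) z)"
    for x z
  have S: "S x z = int CARD('p) * of_bool (z = x)" for x z
  proof -
    define a b c where "a = (z - x) $ 1" and "b = (z - x) $ 2" and "c = (z - x) $ 3"
    have 1: "z \<in> line_through x (?d t) \<longleftrightarrow> b = a * t \<and> c = 0" for t
      by (auto simp: mem_line_through a_def b_def c_def vec_eq_iff forall_3)
    have 2: "z \<in> line_through x ?e2 \<longleftrightarrow> a = 0 \<and> c = 0"
      by (auto simp: mem_line_through a_def b_def c_def vec_eq_iff forall_3)
    have 3: "z \<in> line_through (x + s *s ?e2) ?e1 \<longleftrightarrow> s = b \<and> c = 0" for s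
      by (auto simp: mem_line_through a_def b_def c_def vec_eq_iff forall_3 algebra_simps intro: exI[of _ "z $ 1 - x $ 1"])
    have 4: "z = x \<longleftrightarrow> a = 0 \<and> b = 0 \<and> c = 0"
      by (auto simp: a_def b_def c_def vec_eq_iff forall_3)
    \<comment> \<open>The slopes \<open>t\<close> whose line contains \<open>z\<close> (when
      \<open>c = 0\<close>): all p if \<open>a = b = 0\<close>, none if only \<open>a = 0\<close>,
      exactly one otherwise.\<close>
    have "b = a * t \<longleftrightarrow> (if a = 0 then b = 0 else t = b / a)" for t
      by (auto simp: field_simps)
    then show ?thesis
      unfolding S_def indicator_def 1 2 3 4
      by (cases "c = 0"; cases "a = 0"; cases "b = 0") (auto simp: of_bool_def)
  qed
  \<comment> \<open>Each line in \<open>S x\<close> is paired with the line of the same direction in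
    \<open>S y\<close>.\<close>
  have "(\<lambda>z. S x z - S y z) = (\<lambda>z. \<Sum>t\<in>UNIV. (char_fun (line_through x (?d t)) - char_fun (line_through y (?d t))) z)
      + (char_fun (line_through x ?e2) - char_fun (line_through y ?e2))
      - (\<lambda>z. \<Sum>s\<in>UNIV. (char_fun (line_through (x + s *s ?e2) ?e1) - char_fun (line_through (y + s *s ?e2) ?e1)) z)"
    by (simp add: fun_eq_iff S_def sum_subtractf)
  also have "\<dots> \<in> int_fun.span line_diffs"
    by (intro int_fun.span_diff int_fun.span_add int_fun_span_sum line_through_diff_in_span nz)
  finally show ?thesis
    by (simp add: S right_diff_distrib)
qed

text \<open>A function of total 0 is the combination, with coefficients \<open>K x\<close>, of the
  differences between the point \<open>x\<close> and the origin.\<close>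

lemma p_multiple_in_span:
  fixes K :: "'p :: prime_card space \<Rightarrow> int"
  assumes "(\<Sum>x\<in>UNIV. K x) = 0"
  shows "(\<lambda>x. int CARD('p) * K x) \<in> int_fun.span line_diffs"
proof -
  have "(\<lambda>z. \<Sum>x\<in>UNIV. K x * (int CARD('p) * (of_bool (z = x) - of_bool (z = 0)))) \<in> int_fun.span line_diffs"
    by (intro int_fun_span_sum int_fun_span_scale p_delta_diff_in_span)
  moreover have "(\<Sum>x\<in>UNIV. K x * (int CARD('p) * (of_bool (z = x) - of_bool (z = 0)))) = int CARD('p) * K z" for z
  proof -
    have "(\<Sum>x\<in>UNIV. K x * (int CARD('p) * (of_bool (z = x) - of_bool (z = 0))))
        = (\<Sum>x\<in>UNIV. int CARD('p) * (if z = x then K x else 0)) - (\<Sum>x\<in>UNIV. K x) * (int CARD('p) * of_bool (z = 0))"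
      unfolding sum_distrib_right sum_subtractf[symmetric]
      by (rule sum.cong) (auto simp: algebra_simps)
    then show ?thesis
      using assms by (simp flip: sum_distrib_left)
  qed
  ultimately show ?thesis by simp
qed

section \<open>Passing to residues modulo p and lifting back\<close>

lemma sum_line:
  fixes l :: "'p :: prime_card space set"
  assumes "line l"
  shows "(\<Sum>x\<in>UNIV. char_fun l x) = int CARD('p)"
proof -
  obtain a v where "v \<noteq> 0" "l = line_through a v" using line_eq_line_through[OF assms] .
  then show ?thesis using card_line_through[of v a] by (simp add: sum.If_cases indicator_def)
qed

text \<open>All lines have p points. In the lifting argument this makes the total of the quotient by
  p vanish.\<close>

lemma sum_span_line_diffs:
  fixes F :: "'p :: prime_card space \<Rightarrow> int"
  assumes "F \<in> int_fun.span line_diffs"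
  shows "(\<Sum>x\<in>UNIV. F x) = 0"
  using assms
proof (induction rule: int_fun.span_induct_alt)
  case (step c x y)
  then show ?case
    by (auto simp: sum.distrib sum_subtractf sum_line simp flip: sum_distrib_left)
qed simp

text \<open>An image of the integer span, so that membership comes with an integer lift. It is still
  a subspace over the prime field, since scalars lift to integers.\<close>

definition mod_p_span :: "('p :: prime_card space \<Rightarrow> 'p mod_ring) set" where
  "mod_p_span = (\<lambda>F x. of_int (F x)) ` int_fun.span line_diffs"

lemma mod_p_span_sum:
  assumes "\<And>i. i \<in> A \<Longrightarrow> f i \<in> mod_p_span"
  shows "(\<lambda>x. \<Sum>i\<in>A. f i x) \<in> mod_p_span"
proof -
  have "\<forall>i\<in>A. \<exists>F. F \<in> int_fun.span line_diffs \<and> (\<forall>x. f i x = of_int (F x))"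
    using assms unfolding mod_p_span_def by fastforce
  from bchoice[OF this] obtain F where F: "\<forall>i\<in>A. F i \<in> int_fun.span line_diffs \<and> (\<forall>x. f i x = of_int (F i x))" ..
  have "(\<lambda>x. \<Sum>i\<in>A. f i x) = (\<lambda>x. of_int (\<Sum>i\<in>A. F i x))"
    unfolding of_int_sum using F by (intro ext sum.cong) simp_all
  moreover have "(\<lambda>x. \<Sum>i\<in>A. F i x) \<in> int_fun.span line_diffs"
    using F by (intro int_fun_span_sum) simp
  ultimately show ?thesis
    unfolding mod_p_span_def by (rule image_eqI)
qed

lemma mod_p_span_scale:
  assumes "f \<in> mod_p_span"
  shows "(\<lambda>x. c * f x) \<in> mod_p_span"
proof -
  obtain n where c: "c = of_int n"
    by (metis of_int_mod_ring_to_int_mod_ring of_int_of_int_mod_ring)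
  from assms obtain F where "F \<in> int_fun.span line_diffs" "f = (\<lambda>x. of_int (F x))"
    unfolding mod_p_span_def by blast
  then show ?thesis
    unfolding mod_p_span_def image_iff c
    by (intro bexI[of _ "\<lambda>x. n * F x"] int_fun_span_scale) auto
qed

lemma mod_p_span_line_through_diff:
  assumes "v \<noteq> 0"
  shows "(\<lambda>x. of_bool (x \<in> line_through a v) - of_bool (x \<in> line_through b v)) \<in> mod_p_span"
  unfolding mod_p_span_def using line_through_diff_in_span[OF assms, of a b]
  by (intro image_eqI) (auto simp: indicator_def)

text \<open>A lift \<open>F'\<close> of the residues differs from \<open>F\<close> by p times some
  \<open>K\<close>. Both have total 0, hence so has \<open>K\<close>, and
  \<open>p_multiple_in_span\<close> absorbs the error.\<close>

lemma in_span_if_mod_p_span: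
  fixes F :: "'p :: prime_card space \<Rightarrow> int"
  assumes "(\<lambda>x. of_int (F x)) \<in> mod_p_span" "(\<Sum>x\<in>UNIV. F x) = 0"
  shows "F \<in> int_fun.span line_diffs"
proof -
  from assms(1) obtain F' where F': "F' \<in> int_fun.span line_diffs"
      and "\<And>x. (of_int (F x) :: 'p mod_ring) = of_int (F' x)"
    unfolding mod_p_span_def by (auto simp: fun_eq_iff)
  then have "int CARD('p) dvd F x - F' x" for x
    by (simp add: of_int_eq_iff_cong_CHAR cong_iff_dvd_diff)
  then obtain K where K: "\<And>x. F x - F' x = int CARD('p) * K x"
    unfolding dvd_def by metis
  have "int CARD('p) * (\<Sum>x\<in>UNIV. K x) = 0"
    using assms(2) sum_span_line_diffs[OF F'] by (simp add: sum_distrib_left K[symmetric] sum_subtractf)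
  then have "(\<lambda>x. int CARD('p) * K x) \<in> int_fun.span line_diffs"
    by (intro p_multiple_in_span) simp
  moreover have "F = F' + (\<lambda>x. int CARD('p) * K x)"
    by (simp add: fun_eq_iff flip: K)
  ultimately show ?thesis
    using F' int_fun.span_add by blast
qed

section \<open>Monomials and moments\<close>

text \<open>The lines of one direction are the fibres of a pair of linear forms, so every function
  of this pair is a combination of their indicators.\<close>

lemma mem_line_through_graph:
  fixes X :: "'p :: prime_card space"
  shows "X \<in> line_through (vector [0, \<gamma>, \<delta>]) (vector [1, - a, - b])
    \<longleftrightarrow> a * X $ 1 + X $ 2 = \<gamma> \<and> b * X $ 1 + X $ 3 = \<delta>"
  by (auto simp: mem_line_through vec_eq_iff forall_3 algebra_simps eq_diff_eq)

text \<open>Weighting the fibre \<open>l q\<close> by \<open>\<phi> q\<close> gives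
  \<open>\<phi>\<close> of the two forms. Subtracting the base line \<open>l 0\<close> throughout
  costs only a multiple of the total of \<open>\<phi>\<close>, which factors into two power
  sums.\<close>

lemma linear_form_powers_in_mod_p_span:
  fixes a b :: "'p :: prime_card mod_ring"
  assumes "r < CARD('p)" "s < CARD('p)" "r + s < 2 * (CARD('p) - 1)"
  shows "(\<lambda>X. (a * X $ 1 + X $ 2) ^ r * (b * X $ 1 + X $ 3) ^ s) \<in> mod_p_span"
proof -
  define \<phi> :: "'p mod_ring \<times> 'p mod_ring \<Rightarrow> 'p mod_ring" where "\<phi> q = fst q ^ r * snd q ^ s" for q
  define l where "l q = line_through (vector [0, fst q, snd q]) (vector [1, - a, - b] :: 'p space)" for q
  have "(vector [1, - a, - b] :: 'p space) \<noteq> 0"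
    by (simp add: vec_eq_iff forall_3)
  then have "(\<lambda>X. \<Sum>q\<in>UNIV. \<phi> q * (of_bool (X \<in> l q) - of_bool (X \<in> l 0))) \<in> mod_p_span"
    unfolding l_def by (intro mod_p_span_sum mod_p_span_scale mod_p_span_line_through_diff)
  moreover have "(\<Sum>q\<in>UNIV. \<phi> q * (of_bool (X \<in> l q) - of_bool (X \<in> l 0)))
      = (a * X $ 1 + X $ 2) ^ r * (b * X $ 1 + X $ 3) ^ s" for X
  proof -
    let ?q = "(a * X $ 1 + X $ 2, b * X $ 1 + X $ 3)"
    \<comment> \<open>Both exponents are at most p - 1 but not both equal to it, so one of the power
      sums vanishes.\<close>
    have "r < CARD('p) - 1 \<or> s < CARD('p) - 1" using assms by linarith
    then have "(\<Sum>t\<in>UNIV. (t :: 'p mod_ring) ^ r) * (\<Sum>t\<in>UNIV. t ^ s) = 0"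
      using sum_power_eq_0[where 'p = 'p] by auto
    then have 0: "(\<Sum>q\<in>UNIV. \<phi> q) = 0"
      by (simp add: \<phi>_def sum_product sum.cartesian_product case_prod_unfold flip: UNIV_Times_UNIV)
    have "X \<in> l q \<longleftrightarrow> q = ?q" for q
      unfolding l_def mem_line_through_graph by auto
    then have "(\<Sum>q\<in>UNIV. \<phi> q * (of_bool (X \<in> l q) - of_bool (X \<in> l 0)))
        = (\<Sum>q\<in>UNIV. if q = ?q then \<phi> q else 0) - (\<Sum>q\<in>UNIV. \<phi> q) * of_bool (X \<in> l 0)"
      unfolding sum_distrib_right sum_subtractf[symmetric]
      by (intro sum.cong refl) (auto simp: algebra_simps)
    then show ?thesis by (simp add: 0) (simp add: \<phi>_def)
  qed
  ultimately show ?thesis by simp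
qed

text \<open>\<open>extract_coeff\<close> applied pointwise in \<open>X\<close>: each coefficient is
  a linear combination of the values at the p choices of \<open>a\<close>.\<close>

lemma mod_p_span_coeff:
  fixes v :: "nat \<Rightarrow> 'p :: prime_card space \<Rightarrow> 'p mod_ring"
  assumes "\<And>a. (\<lambda>X. \<Sum>i<CARD('p). a ^ i * v i X) \<in> mod_p_span" "k < CARD('p)"
  shows "v k \<in> mod_p_span"
proof -
  have "v k = (\<lambda>X. \<Sum>t\<in>UNIV. dual_monom k t * (\<Sum>i<CARD('p). t ^ i * v i X))"
    using extract_coeff[OF assms(2), of "\<lambda>i. v i X" for X] by (rule ext)
  also have "\<dots> \<in> mod_p_span"
    by (rule mod_p_span_sum, rule mod_p_span_scale, rule assms(1))
  finally show ?thesis .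
qed

text \<open>With \<open>A = i + j\<close>, the coefficient of \<open>a ^ i * b ^ j\<close> in the
  product of the powers \<open>B + i\<close> and \<open>C + j\<close> of the two linear forms is the
  desired monomial times two binomial coefficients, which are units modulo p.\<close>

lemma monomial_in_mod_p_span:
  assumes "A < CARD('p)" "B < CARD('p)" "C < CARD('p)" "A + B + C < 2 * (CARD('p) - 1)"
  shows "(\<lambda>X :: 'p :: prime_card space. X $ 1 ^ A * X $ 2 ^ B * X $ 3 ^ C) \<in> mod_p_span"
proof -
  \<comment> \<open>Both powers must stay below p. Either all of \<open>A\<close> fits on top of
    \<open>B\<close>, or \<open>B\<close> is filled up to p - 1 and the rest goes to
    \<open>C\<close>; then the degree bound gives \<open>C + j < p - 1\<close>.\<close>
  obtain i j where A: "A = i + j" and r: "B + i < CARD('p)" and s: "C + j < CARD('p)"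
  proof (cases "A + B < CARD('p)")
    case True
    then show ?thesis using that[of A 0] assms by simp
  next
    case False
    then show ?thesis using that[of "CARD('p) - 1 - B" "A + B - (CARD('p) - 1)"] assms by auto
  qed
  define r s where "r = B + i" and "s = C + j"
  have lt: "i < CARD('p)" "j < CARD('p)" and le: "i \<le> r" "j \<le> s"
    and r': "r < CARD('p)" and s': "s < CARD('p)" and rs: "r + s < 2 * (CARD('p) - 1)"
    using r s A assms(4) by (simp_all add: r_def s_def)
  have "(\<lambda>X. of_nat (r choose i) * (X $ 1 ^ i * X $ 2 ^ (r - i)) * (b * X $ 1 + X $ 3) ^ s)
      \<in> mod_p_span" for b :: "'p mod_ring"
  proof (rule mod_p_span_coeff[OF _ lt(1), of "\<lambda>i X. of_nat (r choose i) * (X $ 1 ^ i * X $ 2 ^ (r - i)) * (b * X $ 1 + X $ 3) ^ s"])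
    fix a :: "'p mod_ring"
    show "(\<lambda>X. \<Sum>i<CARD('p). a ^ i * (of_nat (r choose i) * (X $ 1 ^ i * X $ 2 ^ (r - i))
        * (b * X $ 1 + X $ 3) ^ s)) \<in> mod_p_span"
      using linear_form_powers_in_mod_p_span[OF r' s' rs, of a b]
      by (simp only: binomial_expand[OF r'] sum_distrib_right mult.assoc)
  qed
  then have "(\<lambda>X. of_nat (r choose i) * (X $ 1 ^ i * X $ 2 ^ (r - i))
      * (\<Sum>j<CARD('p). b ^ j * (of_nat (s choose j) * (X $ 1 ^ j * X $ 3 ^ (s - j)))))
      \<in> mod_p_span" for b :: "'p mod_ring"
    by (simp only: binomial_expand[OF s'])
  then have "(\<lambda>X. of_nat (r choose i) * (X $ 1 ^ i * X $ 2 ^ (r - i))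
      * (of_nat (s choose j) * (X $ 1 ^ j * X $ 3 ^ (s - j)))) \<in> (mod_p_span :: ('p space \<Rightarrow> _) set)"
    using mod_p_span_coeff[OF _ lt(2), of "\<lambda>j X. of_nat (r choose i) * (X $ 1 ^ i * X $ 2 ^ (r - i))
      * (of_nat (s choose j) * (X $ 1 ^ j * X $ 3 ^ (s - j)))"]
    by (simp add: sum_distrib_left mult_ac)
  then have "(\<lambda>X. inverse (of_nat (r choose i) * of_nat (s choose j)) *
      (of_nat (r choose i) * (X $ 1 ^ i * X $ 2 ^ (r - i))
      * (of_nat (s choose j) * (X $ 1 ^ j * X $ 3 ^ (s - j))))) \<in> (mod_p_span :: ('p space \<Rightarrow> _) set)"
    by (rule mod_p_span_scale)
  moreover have "inverse (of_nat (r choose i) * of_nat (s choose j)) *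
      (of_nat (r choose i) * (X $ 1 ^ i * X $ 2 ^ (r - i))
      * (of_nat (s choose j) * (X $ 1 ^ j * X $ 3 ^ (s - j))))
      = X $ 1 ^ A * X $ 2 ^ B * X $ 3 ^ C" for X :: "'p space"
    using binomial_mod_ring_neq_0[OF le(1), where 'p = 'p] binomial_mod_ring_neq_0[OF le(2), where 'p = 'p] r s
    by (simp add: A r_def s_def power_add field_simps)
  ultimately show ?thesis by simp
qed

text \<open>A power of \<open>a * X $ 1 + b * X $ 2 + X $ 3\<close> is constant on each plane of the
  family, so its sum against \<open>f\<close> vanishes for all \<open>a\<close> and
  \<open>b\<close>. As a polynomial of degree below p in each of them it has zero coefficients, and
  these are moments times binomial units.\<close>

lemma moment_eq_0:
  fixes f :: "'p :: prime_card space \<Rightarrow> 'p mod_ring"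
  assumes f: "\<And>a b c. (\<Sum>X | a * X $ 1 + b * X $ 2 + X $ 3 = c. f X) = 0"
    and "i + j + k < CARD('p)"
  shows "(\<Sum>X\<in>UNIV. f X * (X $ 1 ^ i * X $ 2 ^ j * X $ 3 ^ k)) = 0"
proof -
  have coeff: "c n = 0" if "\<And>a. (\<Sum>m<CARD('p). a ^ m * c m) = 0" "n < CARD('p)"
    for c :: "nat \<Rightarrow> 'p mod_ring" and n
    using extract_coeff[OF that(2), of c] that(1) by simp
  define m where "m = i + j + k"
  have lt: "i < CARD('p)" "j < CARD('p)" "m < CARD('p)" "m - i < CARD('p)"
    using assms(2) by (auto simp: m_def)
  have "(\<Sum>X\<in>UNIV. f X * (a * X $ 1 + (b * X $ 2 + X $ 3)) ^ m) = 0" for a b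
  proof -
    let ?g = "\<lambda>X :: 'p space. a * X $ 1 + b * X $ 2 + X $ 3"
    have "(\<Sum>X\<in>UNIV. f X * ?g X ^ m) = (\<Sum>c\<in>UNIV. \<Sum>X | X \<in> UNIV \<and> ?g X = c. f X * ?g X ^ m)"
      by (rule sum.group[symmetric]) auto
    also have "\<dots> = (\<Sum>c\<in>UNIV. (\<Sum>X | ?g X = c. f X) * c ^ m)"
      unfolding sum_distrib_right by (intro sum.cong) auto
    also have "\<dots> = 0" by (simp only: f mult_zero_left sum.neutral_const)
    finally show ?thesis by (simp only: add.assoc)
  qed
  then have "(\<Sum>n<CARD('p). a ^ n * (\<Sum>X\<in>UNIV. f X *
      (of_nat (m choose n) * (X $ 1 ^ n * (b * X $ 2 + X $ 3) ^ (m - n))))) = 0" for a b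
    unfolding binomial_expand[OF lt(3)] sum_distrib_left
    by (subst sum.swap) (simp add: mult_ac)
  then have "(\<Sum>X\<in>UNIV. f X *
      (of_nat (m choose i) * (X $ 1 ^ i * (b * X $ 2 + X $ 3) ^ (m - i)))) = 0" for b
    by (rule coeff[OF _ lt(1)])
  then have "(\<Sum>n<CARD('p). b ^ n * (\<Sum>X\<in>UNIV. f X * (of_nat (m choose i) * (X $ 1 ^ i *
      (of_nat (m - i choose n) * (X $ 2 ^ n * X $ 3 ^ (m - i - n))))))) = 0" for b
    unfolding binomial_expand[OF lt(4)] sum_distrib_left
    by (subst sum.swap) (simp add: mult_ac)
  then have "(\<Sum>X\<in>UNIV. f X * (of_nat (m choose i) * (X $ 1 ^ i *
      (of_nat (m - i choose j) * (X $ 2 ^ j * X $ 3 ^ (m - i - j)))))) = 0"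
    by (rule coeff[OF _ lt(2)])
  then have "of_nat (m choose i) * of_nat (m - i choose j) *
      (\<Sum>X\<in>UNIV. f X * (X $ 1 ^ i * X $ 2 ^ j * X $ 3 ^ (m - i - j))) = 0"
    by (simp add: sum_distrib_left mult_ac)
  moreover have "(of_nat (m choose i) :: 'p mod_ring) \<noteq> 0" "(of_nat (m - i choose j) :: 'p mod_ring) \<noteq> 0"
    by (rule binomial_mod_ring_neq_0; use lt in \<open>simp add: m_def\<close>)+
  ultimately show ?thesis by (simp add: m_def)
qed

text \<open>The complementary exponents \<open>p - 1 - i\<close>, \<open>p - 1 - j\<close>,
  \<open>p - 1 - k\<close> add up to at most p - 1, so expanding the product of dual monomials
  yields only moments that vanish.\<close>

lemma dual_moment_eq_0:
  fixes f :: "'p :: prime_card space \<Rightarrow> 'p mod_ring"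
  assumes f: "\<And>a b c. (\<Sum>X | a * X $ 1 + b * X $ 2 + X $ 3 = c. f X) = 0"
    and "i < CARD('p)" "j < CARD('p)" "k < CARD('p)" "2 * (CARD('p) - 1) \<le> i + j + k"
  shows "(\<Sum>X\<in>UNIV. f X * (dual_monom i (X $ 1) * dual_monom j (X $ 2) * dual_monom k (X $ 3))) = 0"
proof -
  define a b c where "a = CARD('p) - 1 - i" and "b = CARD('p) - 1 - j" and "c = CARD('p) - 1 - k"
  have abc: "a + b + c < CARD('p)" using assms by (simp add: a_def b_def c_def)
  define M where "M i j k = (\<Sum>X\<in>UNIV. f X * (X $ 1 ^ i * X $ 2 ^ j * X $ 3 ^ k))" for i j k
  have M: "M i j k = 0" if "i \<le> a" "j \<le> b" "k \<le> c" for i j k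
    unfolding M_def by (rule moment_eq_0[OF f]) (use that abc in auto)
  \<comment> \<open>\<open>x\<close>, \<open>y\<close>, \<open>z\<close> stand for the constants
    \<open>of_bool (i = 0)\<close> etc. of the dual monomials.\<close>
  have expand: "(\<Sum>X\<in>UNIV. f X * ((x - X $ 1 ^ a) * (y - X $ 2 ^ b) * (z - X $ 3 ^ c)))
      = x * y * z * M 0 0 0 - x * y * M 0 0 c - x * z * M 0 b 0 - y * z * M a 0 0
        + x * M 0 b c + y * M a 0 c + z * M a b 0 - M a b c" for x y z
    unfolding M_def sum_distrib_left
    by (simp add: algebra_simps sum.distrib sum_subtractf)
  show ?thesis
    unfolding dual_monom_def a_def[symmetric] b_def[symmetric] c_def[symmetric] expand
    by (simp add: M)
qed

text \<open>Write \<open>f\<close> as a sum of point indicators and each of these as a product of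
  three expansions \<open>sum_dual_monom\<close>. Then the monomial \<open>g q\<close> has the dual
  moment \<open>M q\<close> as coefficient, and either its degree is small enough or
  \<open>M q\<close> vanishes.\<close>

lemma in_mod_p_span_if_plane_sums_0:
  fixes f :: "'p :: prime_card space \<Rightarrow> 'p mod_ring"
  assumes f: "\<And>a b c. (\<Sum>X | a * X $ 1 + b * X $ 2 + X $ 3 = c. f X) = 0"
  shows "f \<in> mod_p_span"
proof -
  let ?I = "{..<CARD('p)} \<times> {..<CARD('p)} \<times> {..<CARD('p)}"
  define M where "M = (\<lambda>(i, j, k). \<Sum>Y\<in>UNIV. f Y *
    (dual_monom i (Y $ 1) * dual_monom j (Y $ 2) * dual_monom k (Y $ 3)))"
  define g :: "nat \<times> nat \<times> nat \<Rightarrow> 'p space \<Rightarrow> 'p mod_ring"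
    where "g = (\<lambda>(i, j, k) X. X $ 1 ^ i * X $ 2 ^ j * X $ 3 ^ k)"
  have "(\<lambda>X. M q * g q X) \<in> mod_p_span" if "q \<in> ?I" for q
  proof -
    obtain i j k where q: "q = (i, j, k)" by (metis prod.exhaust)
    show ?thesis
    proof (cases "i + j + k < 2 * (CARD('p) - 1)")
      case True
      then show ?thesis
        using that by (auto simp: q g_def intro!: mod_p_span_scale monomial_in_mod_p_span)
    next
      case False
      then have "M q = 0"
        using that dual_moment_eq_0[OF f, of i j k] by (simp add: q M_def)
      \<comment> \<open>The zero function is the empty sum.\<close>
      then show ?thesis using mod_p_span_sum[of "{}"] by simp
    qed
  qed
  then have "(\<lambda>X. \<Sum>q\<in>?I. M q * g q X) \<in> mod_p_span"
    by (rule mod_p_span_sum)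
  moreover have "(\<Sum>q\<in>?I. M q * g q X) = f X" for X
  proof -
    have prod3: "(\<Sum>i<CARD('p). A i) * ((\<Sum>j<CARD('p). B j) * (\<Sum>k<CARD('p). C k))
        = (\<Sum>q\<in>?I. A (fst q) * (B (fst (snd q)) * C (snd (snd q))))"
      for A B C :: "nat \<Rightarrow> 'p mod_ring"
      by (simp add: sum_product sum.cartesian_product case_prod_unfold)
    have "(\<Sum>q\<in>?I. M q * g q X) = (\<Sum>Y\<in>UNIV. \<Sum>q\<in>?I. f Y * (X $ 1 ^ fst q * dual_monom (fst q) (Y $ 1)
        * (X $ 2 ^ fst (snd q) * dual_monom (fst (snd q)) (Y $ 2)
        * (X $ 3 ^ snd (snd q) * dual_monom (snd (snd q)) (Y $ 3)))))"
      unfolding M_def g_def case_prod_unfold sum_distrib_right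
      by (subst sum.swap) (simp only: mult_ac)
    also have "\<dots> = (\<Sum>Y\<in>UNIV. f Y * ((\<Sum>i<CARD('p). X $ 1 ^ i * dual_monom i (Y $ 1))
        * ((\<Sum>j<CARD('p). X $ 2 ^ j * dual_monom j (Y $ 2))
        * (\<Sum>k<CARD('p). X $ 3 ^ k * dual_monom k (Y $ 3)))))"
      unfolding prod3 by (simp only: sum_distrib_left)
    also have "\<dots> = (\<Sum>Y\<in>UNIV. if Y = X then f Y else 0)"
      unfolding sum_dual_monom by (rule sum.cong) (auto simp: vec_eq_iff forall_3)
    finally show ?thesis by simp
  qed
  ultimately show ?thesis by simp
qed

section \<open>Indicators of planes and the first claim\<close>

lemma card_plane:
  fixes H :: "'p :: prime_card space set"
  assumes "plane H"
  shows "card H = CARD('p) ^ 2"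
proof -
  obtain a u v where "bij_betw (\<lambda>(s, t). a + s *s u + t *s v) UNIV H"
    using plane_parametrization[OF assms] .
  then show ?thesis
    using bij_betw_same_card by (fastforce simp: power2_eq_square simp flip: UNIV_Times_UNIV)
qed

text \<open>In a parametrization of \<open>H\<close> by \<open>s\<close> and \<open>t\<close> the
  equation becomes affine. If \<open>t\<close> occurs in it, each of the p values of
  \<open>s\<close> admits exactly one \<open>t\<close>; otherwise \<open>t\<close> is free and each
  \<open>s\<close> contributes 0 or p.\<close>

lemma plane_sum_plane:
  fixes H :: "'p :: prime_card space set"
  assumes "plane H"
  shows "(\<Sum>X | a * X $ 1 + b * X $ 2 + X $ 3 = c. of_bool (X \<in> H)) = (0 :: 'p mod_ring)"
proof -
  obtain h u v where bij: "bij_betw (\<lambda>(s, t). h + s *s u + t *s v) UNIV H"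
    using plane_parametrization[OF assms] .
  let ?g = "\<lambda>X :: 'p space. a * X $ 1 + b * X $ 2 + X $ 3"
  have g: "?g (h + s *s u + t *s v) = ?g h + s * ?g u + t * ?g v" for s t
    by (simp add: algebra_simps)
  have "(\<Sum>X | ?g X = c. of_bool (X \<in> H)) = (\<Sum>X\<in>H. of_bool (?g X = c) :: 'p mod_ring)"
    by (simp add: of_bool_def sum.If_cases Int_def conj_commute)
  also have "\<dots> = (\<Sum>q\<in>UNIV. of_bool (?g ((\<lambda>(s, t). h + s *s u + t *s v) q) = c))"
    by (rule sum.reindex_bij_betw[OF bij, symmetric])
  also have "\<dots> = (\<Sum>s\<in>UNIV. \<Sum>t\<in>UNIV. of_bool (?g h + s * ?g u + t * ?g v = c))"
    unfolding sum.cartesian_product UNIV_Times_UNIV by (simp only: case_prod_unfold g)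
  also have "\<dots> = 0"
  proof (cases "?g v = 0")
    case False
    then have "?g h + s * ?g u + t * ?g v = c \<longleftrightarrow> t = (c - ?g h - s * ?g u) / ?g v" for s t
      by (auto simp: field_simps)
    then show ?thesis by (simp add: of_bool_def)
  qed (simp only: mult_zero_right sum_constant CARD_mod_ring of_nat_card_eq_0 mult_zero_left sum.neutral_const)
  finally show ?thesis .
qed

text \<open>Modulo p, the plane sums of \<open>w\<close> and of the indicator of \<open>H\<close>
  both vanish, and the totals are both \<open>p ^ 2\<close>, so the difference satisfies both
  conditions for lifting.\<close>

lemma diff_plane_in_span:
  fixes w :: "'p :: prime_card space \<Rightarrow> nat"
  assumes "p_divisible w" "(\<Sum>x\<in>UNIV. w x) = CARD('p) ^ 2" "plane H"
  shows "(\<lambda>x. int (w x)) - char_fun H \<in> int_fun.span line_diffs"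
proof (rule in_span_if_mod_p_span)
  have "(of_nat (\<Sum>X | a * X $ 1 + b * X $ 2 + X $ 3 = c. w X) :: 'p mod_ring) = of_nat 0" for a b c
    unfolding of_nat_eq_iff_cong_CHAR semiring_char_mod_ring
    using assms(1) plane_graph[of a b c] unfolding p_divisible_def by blast
  then show "(\<lambda>x. of_int (((\<lambda>x. int (w x)) - char_fun H) x)) \<in> (mod_p_span :: ('p space \<Rightarrow> _) set)"
    using plane_sum_plane[OF assms(3)]
    by (intro in_mod_p_span_if_plane_sums_0) (simp add: sum_subtractf indicator_def)
next
  show "(\<Sum>x\<in>UNIV. ((\<lambda>x. int (w x)) - char_fun H) x) = 0"
    using assms(2) card_plane[OF assms(3)]
    by (simp add: sum_subtractf indicator_def sum.If_cases flip: of_nat_sum)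
qed

section \<open>Cylinders\<close>

lemma line_through_eq:
  assumes "z \<in> line_through a v"
  shows "line_through a v = line_through z v"
proof -
  obtain s where z: "z = a + s *s v" using assms unfolding line_through_def by blast
  have "line_through a v = (\<lambda>t. a + t *s v) ` ((\<lambda>t. s + t) ` UNIV)"
    by (simp add: line_through_def)
  also have "\<dots> = line_through z v"
    unfolding line_through_def image_image z by (simp add: vec.scale_left_distrib add.assoc)
  finally show ?thesis .
qed

lemma pairwise_disjnt_lines_through: "pairwise disjnt (range (\<lambda>x. line_through x v))"
proof (rule pairwiseI)
  fix l m assume "l \<in> range (\<lambda>x. line_through x v)" "m \<in> range (\<lambda>x. line_through x v)" "l \<noteq> m"
  then show "disjnt l m" unfolding disjnt_iff using line_through_eq by blast
qed

lemma cylinder_Union_lines_through: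
  fixes v :: "'p :: prime_card space"
  assumes "v \<noteq> 0" "L \<subseteq> range (\<lambda>x. line_through x v)" "card L = CARD('p)"
  shows "cylinder (\<Union>L)"
  unfolding cylinder_def
proof (intro exI[of _ L] conjI assms(3) refl)
  show "\<forall>l\<in>L. line l" using assms line_line_through by blast
  show "pairwise (\<parallel>) L" using assms(2) parallel_line_through unfolding pairwise_def by blast
  show "pairwise disjnt L" by (rule pairwise_subset[OF pairwise_disjnt_lines_through assms(2)])
qed

text \<open>The lines in direction \<open>v\<close> cover all \<open>p ^ 3\<close> points with p
  points each.\<close>

lemma card_lines_through:
  fixes v :: "'p :: prime_card space"
  assumes "v \<noteq> 0"
  shows "CARD('p) ^ 2 \<le> card (range (\<lambda>x. line_through x v))" (is "_ \<le> card ?L")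
proof -
  have "x \<in> line_through x v" for x
    unfolding mem_line_through by (rule exI[of _ 0]) simp
  then have "UNIV = \<Union>?L" by blast
  then have "CARD('p space) \<le> sum card ?L"
    by (metis card_Union_le_sum_card)
  also have "\<dots> = CARD('p) * card ?L"
  proof -
    have "sum card ?L = (\<Sum>l\<in>?L. CARD('p))"
      using card_line_through[OF assms] by (intro sum.cong) auto
    then show ?thesis by (simp add: mult.commute)
  qed
  finally have "CARD('p) * CARD('p) ^ 2 \<le> CARD('p) * card ?L"
    by (simp add: power3_eq_cube power2_eq_square)
  then show ?thesis by simp
qed

text \<open>Complete \<open>l1\<close> and \<open>l2\<close> to cylinders by the same \<open>p - 1\<close> further parallel lines.\<close>

lemma parallel_diff_in_span_cylinders:
  fixes l1 l2 :: "'p :: prime_card space set"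
  assumes "line l1" "l1 \<parallel> l2"
  shows "char_fun l1 - char_fun l2 \<in> int_fun.span {char_fun C | C. cylinder C}"
proof (cases "l1 = l2")
  case True
  then show ?thesis by (simp add: int_fun.span_zero)
next
  case False
  obtain a v where v: "v \<noteq> 0" and l1: "l1 = line_through a v"
    using line_eq_line_through[OF assms(1)] .
  then obtain b where l2: "l2 = line_through b v"
    using assms(2) unfolding parallel_def by (metis line_through_translate)
  define L where "L = range (\<lambda>x. line_through x v)"
  have L: "l1 \<in> L" "l2 \<in> L" by (auto simp: L_def l1 l2)
  have p: "CARD('p) \<ge> 2" using prime_card[where 'a = 'p] prime_ge_2_nat by blast
  \<comment> \<open>Without \<open>l1\<close> and \<open>l2\<close> the parallel class still has at
    least \<open>p ^ 2 - 2\<close>, hence at least p - 1, lines.\<close>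
  have "CARD('p) + 1 \<le> CARD('p) ^ 2"
    using mult_le_mono1[OF p, of "CARD('p)"] p unfolding power2_eq_square by linarith
  then have "CARD('p) - 1 \<le> card (L - {l1, l2})"
    using card_lines_through[OF v] L False by (simp add: L_def card_Diff_subset)
  then obtain T where T: "T \<subseteq> L - {l1, l2}" "card T = CARD('p) - 1" "finite T"
    by (rule obtain_subset_with_card_n)
  have cyl: "cylinder (\<Union>(insert l T))" and char: "char_fun (\<Union>(insert l T)) = char_fun l + char_fun (\<Union>T)"
    if "l \<in> {l1, l2}" for l
  proof -
    have "l \<notin> T" "l \<in> L" using T that L by auto
    then show "cylinder (\<Union>(insert l T))"
      using T p by (intro cylinder_Union_lines_through[OF v]) (auto simp: L_def)
    have "disjnt l m" if "m \<in> T" for m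
    proof (rule pairwiseD[OF pairwise_disjnt_lines_through[of v]])
      show "l \<in> range (\<lambda>x. line_through x v)" using \<open>l \<in> L\<close> by (simp only: L_def)
      show "m \<in> range (\<lambda>x. line_through x v)" using that T(1) unfolding L_def by blast
      show "l \<noteq> m" using that \<open>l \<notin> T\<close> by metis
    qed
    then have "l \<inter> \<Union>T = {}" by (simp add: disjnt_def Int_Union)
    then show "char_fun (\<Union>(insert l T)) = char_fun l + char_fun (\<Union>T)"
      unfolding Union_insert by (intro ext) (simp add: indicator_add)
  qed
  \<comment> \<open>The contribution of the shared lines \<open>T\<close> cancels.\<close>
  have "char_fun l1 - char_fun l2 = char_fun (\<Union>(insert l1 T)) - char_fun (\<Union>(insert l2 T))"
    using char[of l1] char[of l2] by simp
  also have "\<dots> \<in> int_fun.span {char_fun C | C. cylinder C}"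
    using cyl by (intro int_fun.span_diff int_fun.span_base) blast+
  finally show ?thesis .
qed

text \<open>For such a plane the indicator can be added back to \<open>w - char_fun H\<close>
  without leaving the span of cylinders.\<close>

lemma exists_plane_cylinder:
  obtains H :: "'p :: prime_card space set" where "plane H" "cylinder H"
proof -
  let ?v = "vector [1, 0, 0] :: 'p space"
  let ?l = "\<lambda>t. line_through (vector [0, t, 0]) ?v"
  \<comment> \<open>The plane \<open>X $ 3 = 0\<close>, written with zero coefficients to match
    \<open>plane_graph\<close>.\<close>
  let ?H = "{X :: 'p space. 0 * X $ 1 + 0 * X $ 2 + X $ 3 = 0}"
  have v: "?v \<noteq> 0" by (simp add: vec_eq_iff forall_3)
  have mem: "X \<in> ?l t \<longleftrightarrow> X $ 2 = t \<and> X $ 3 = 0" for X t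
    by (auto simp: mem_line_through vec_eq_iff forall_3)
  have "inj ?l"
  proof (rule injI)
    fix s t assume "?l s = ?l t"
    then have "vector [0, s, 0] \<in> ?l t" using mem[of "vector [0, s, 0]" s] by simp
    then show "s = t" using mem by simp
  qed
  then have "cylinder (\<Union>(range ?l))"
    by (intro cylinder_Union_lines_through[OF v]) (auto simp: card_image)
  also have "\<Union>(range ?l) = ?H" using mem by auto
  finally show ?thesis using that plane_graph by blast
qed

theorem theorem1p13:
  fixes w :: "('p :: prime_card) space \<Rightarrow> nat"
  assumes "p_divisible w"
    and "(\<Sum>x\<in>UNIV. w x) = CARD('p) ^ 2"
  shows "(\<forall>H :: 'p space set. plane H \<longrightarrow>
            (\<lambda>x. int (w x)) - char_fun H
              \<in> int_fun.span {char_fun l1 - char_fun l2 | l1 l2. line l1 \<and> line l2 \<and> l1 \<parallel> l2})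
       \<and> (\<lambda>x. int (w x)) \<in> int_fun.span {char_fun C | C. cylinder C}"
proof
  show "\<forall>H :: 'p space set. plane H \<longrightarrow> (\<lambda>x. int (w x)) - char_fun H \<in> int_fun.span line_diffs"
    using diff_plane_in_span[OF assms] by blast
next
  let ?C = "int_fun.span {char_fun C | C :: 'p space set. cylinder C}"
  obtain H :: "'p space set" where H: "plane H" "cylinder H"
    by (rule exists_plane_cylinder)
  have "line_diffs \<subseteq> ?C"
    using parallel_diff_in_span_cylinders by blast
  then have "int_fun.span line_diffs \<subseteq> ?C"
    by (rule int_fun.span_minimal) (rule int_fun.subspace_span)
  then have "((\<lambda>x. int (w x)) - char_fun H) + char_fun H \<in> ?C"
    using diff_plane_in_span[OF assms H(1)] H(2)
    by (intro int_fun.span_add) (auto intro: int_fun.span_base)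
  then show "(\<lambda>x. int (w x)) \<in> ?C"
    by (simp only: diff_add_cancel)
qed

end
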